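(* Let $D\ge 2$, $\rho\in(0.5,1)$ and $B\ge 1$, and suppose that $1-(2\rho-1)^2B^4<0$. Let $(\vec x_1,y_1,a_1),\dots,(\vec x_n,y_n,a_n)$ be an i.i.d. sample from the biased-sampled data model $p_\rho$, and for $k\in\{1,-1\}$ let $$U_k=\{\vec x_i : y_i=k,\ d(\vec x_i,\rho)>0\},\qquad V_k=\{\vec x_i : y_i=k\}\setminus U_k$$ (as collections of sample points indexed by $i$, with $|U_k|$, $|V_k|$ the numbers of such indices). Then, for each $k\in\{1,-1\}$, $$C_k=\mathbb E\left(\frac{1}{2|U_k|}\sum_{\vec u\in U_k}\vec u+\frac{1}{2|V_k|}\sum_{\vec v\in V_k}\vec v\right),$$ where the expectation is over the sample, conditional on $|U_k|>0$ and $|V_k|>0$ (with $n\ge 2$, so that this event has positive probability), and $C_k=C_k^{0.5}$ is the class-$k$ conditional mean under unbiased sampling.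
   Context: Data model $p_\rho$ (parameters: dimension $D$, bias level $\rho$, scalar constant $B$). A data point is a triple $(\vec x,y,a)$ generated as follows. The label $y$ is uniform on $\{1,-1\}$. Given $y=k$, the spurious attribute $a\in\{1,-1\}$ satisfies $P(a=k\mid y=k)=\rho$ and $P(a=-k\mid y=k)=1-\rho$. The noise $\vec\delta\sim\mathcal N(\vec 0,\vec I^{D-2})$ is a standard Gaussian vector in $\mathbb R^{D-2}$, independent of $(y,a)$. The feature vector is $\vec x=[Ba,\;y,\;\vec\delta]\in\mathbb R^{D}$. The same definition with $\rho=0.5$ (and the same $B$ and $D$) gives the true, unbiased data distribution $p_{0.5}$. Centroids. For $k\in\{1,-1\}$, $C_k^{\rho}=\mathbb E[\vec x\mid y=k]$ under $p_\rho$, and $C_k=C_k^{0.5}$ is the same conditional mean under $p_{0.5}$. Relative distance. For a data point $(\vec x_i,y_i)$, $$d(\vec x_i,\rho)=\|\vec x_i-C_{y_i}^{\rho}\|_2^2-\|\vec x_i-C_{q_i}^{\rho}\|_2^2,\qquad q_i=\arg\min_{u\neq y_i}\|\vec x_i-C_u^{\rho}\|_2^2 .$$ Since there are only two classes, $q_i=-y_i$. The value $d(\vec x_i,\rho)$ depends on the label $y_i$ of the point as well as on $\vec x_i$. *)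

theory Defs
  imports "HOL-Probability.Probability"
begin

text \<open>
  Feature vectors live in \<open>real ^ 'n\<close>, so \<open>CARD('n)\<close> is the dimension \<open>D\<close>.  Instead of ordering the
  coordinates we name two of them: \<open>s\<close> carries the spurious feature \<open>B * a\<close> and \<open>c\<close> the core feature
  \<open>y\<close>.  The other \<open>D - 2\<close> coordinates (possibly none) carry the noise.  Requiring \<open>s \<noteq> c\<close> amounts to
  \<open>D \<ge> 2\<close>.  A data point is a triple \<open>(x, y, a)\<close>.
\<close>

type_synonym 'n point = "(real ^ 'n) \<times> int \<times> int"

definition classes :: "int set"
  where "classes = {1, -1}"

abbreviation feature :: "'n point \<Rightarrow> real ^ 'n"
  where "feature z \<equiv> fst z"

abbreviation label :: "'n point \<Rightarrow> int"
  where "label z \<equiv> fst (snd z)"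

definition point_space :: "'n::finite point measure"
  where "point_space = borel \<Otimes>\<^sub>M count_space UNIV \<Otimes>\<^sub>M count_space UNIV"

definition label_attribute_pmf :: "real \<Rightarrow> (int \<times> int) pmf"
  where "label_attribute_pmf \<rho> =
    do {
      y \<leftarrow> pmf_of_set classes;
      agree \<leftarrow> bernoulli_pmf \<rho>;
      return_pmf (y, if agree then y else - y)
    }"

definition noise_measure :: "'n::finite \<Rightarrow> 'n \<Rightarrow> ('n \<Rightarrow> real) measure"
  where "noise_measure s c = (\<Pi>\<^sub>M j\<in>- {s, c}. density lborel std_normal_density)"

definition feature_vector ::
    "'n::finite \<Rightarrow> 'n \<Rightarrow> real \<Rightarrow> int \<Rightarrow> int \<Rightarrow> ('n \<Rightarrow> real) \<Rightarrow> real ^ 'n"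
  where "feature_vector s c B y a \<delta> =
    (\<chi> j. if j = s then B * of_int a else if j = c then of_int y else \<delta> j)"

definition data_model :: "'n::finite \<Rightarrow> 'n \<Rightarrow> real \<Rightarrow> real \<Rightarrow> 'n point measure"
  where "data_model s c B \<rho> =
    distr (measure_pmf (label_attribute_pmf \<rho>) \<Otimes>\<^sub>M noise_measure s c) point_space
      (\<lambda>((y, a), \<delta>). (feature_vector s c B y a \<delta>, y, a))"

text \<open>
  Conditional expectation given an event \<open>A\<close>; meaningful only if \<open>A\<close> has positive probability, since
  otherwise \<open>uniform_measure M A\<close> is not a probability measure.
\<close>

definition event_expectation ::
    "'a measure \<Rightarrow> 'a set \<Rightarrow> ('a \<Rightarrow> 'b) \<Rightarrow> 'b::{banach, second_countable_topology}"
  where "event_expectation M A f = (LINT \<omega>|uniform_measure M A. f \<omega>)"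

definition centroid :: "'n::finite \<Rightarrow> 'n \<Rightarrow> real \<Rightarrow> real \<Rightarrow> int \<Rightarrow> real ^ 'n"
  where "centroid s c B \<rho> k =
    event_expectation (data_model s c B \<rho>)
      {z \<in> space (data_model s c B \<rho>). label z = k} feature"

definition nearest_other_class :: "'n::finite \<Rightarrow> 'n \<Rightarrow> real \<Rightarrow> real \<Rightarrow> 'n point \<Rightarrow> int"
  where "nearest_other_class s c B \<rho> z =
    arg_min_on (\<lambda>u. (norm (feature z - centroid s c B \<rho> u))\<^sup>2) (classes - {label z})"

definition relative_distance :: "'n::finite \<Rightarrow> 'n \<Rightarrow> real \<Rightarrow> real \<Rightarrow> 'n point \<Rightarrow> real"
  where "relative_distance s c B \<rho> z =
    (norm (feature z - centroid s c B \<rho> (label z)))\<^sup>2 -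
    (norm (feature z - centroid s c B \<rho> (nearest_other_class s c B \<rho> z)))\<^sup>2"

text \<open>
  For a sample \<open>z 0, \<dots>, z (n - 1)\<close> the collections \<open>U\<^sub>k\<close> and \<open>V\<^sub>k\<close> are represented by
  their sets of sample indices, so that repeated feature vectors are counted with multiplicity.
\<close>

definition U_indices ::
    "'n::finite \<Rightarrow> 'n \<Rightarrow> real \<Rightarrow> real \<Rightarrow> nat \<Rightarrow> int \<Rightarrow> (nat \<Rightarrow> 'n point) \<Rightarrow> nat set"
  where "U_indices s c B \<rho> n k z =
    {i. i < n \<and> label (z i) = k \<and> relative_distance s c B \<rho> (z i) > 0}"

definition V_indices ::
    "'n::finite \<Rightarrow> 'n \<Rightarrow> real \<Rightarrow> real \<Rightarrow> nat \<Rightarrow> int \<Rightarrow> (nat \<Rightarrow> 'n point) \<Rightarrow> nat set"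
  where "V_indices s c B \<rho> n k z = {i. i < n \<and> label (z i) = k} - U_indices s c B \<rho> n k z"

definition balanced_mean ::
    "'n::finite \<Rightarrow> 'n \<Rightarrow> real \<Rightarrow> real \<Rightarrow> nat \<Rightarrow> int \<Rightarrow> (nat \<Rightarrow> 'n point) \<Rightarrow> real ^ 'n"
  where "balanced_mean s c B \<rho> n k z =
    (1 / (2 * real (card (U_indices s c B \<rho> n k z)))) *\<^sub>R
      (\<Sum>i\<in>U_indices s c B \<rho> n k z. feature (z i)) +
    (1 / (2 * real (card (V_indices s c B \<rho> n k z)))) *\<^sub>R
      (\<Sum>i\<in>V_indices s c B \<rho> n k z. feature (z i))"

definition both_nonempty_event ::
    "'w measure \<Rightarrow> 'n::finite \<Rightarrow> 'n \<Rightarrow> real \<Rightarrow> real \<Rightarrow> nat \<Rightarrow> int \<Rightarrow> (nat \<Rightarrow> 'w \<Rightarrow> 'n point) \<Rightarrow> 'w set"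
  where "both_nonempty_event M s c B \<rho> n k Z =
    {\<omega> \<in> space M. card (U_indices s c B \<rho> n k (\<lambda>i. Z i \<omega>)) > 0 \<and>
                   card (V_indices s c B \<rho> n k (\<lambda>i. Z i \<omega>)) > 0}"

end

theory Submission
  imports Defs
begin

text \<open>
  Almost surely \<open>d(x, \<rho>) = - 4 (B\<^sup>2 (2 \<rho> - 1) a y + 1)\<close>, so the hypothesis on \<open>B\<close> and \<open>\<rho>\<close> makes
  \<open>U\<^sub>k\<close> the minority group \<open>a = - k\<close> and \<open>V\<^sub>k\<close> the majority group \<open>a = k\<close>.  Negating all noise
  coordinates preserves the law of the sample and both index sets, and the balanced means of a sample
  and of its reflection add up to the constant vector with core coordinate \<open>2 k\<close> and all other
  coordinates 0.  Integrating over the conditioning event therefore gives \<open>C\<^sub>k\<close>, and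
  the joint law of the group sizes and the noise is never needed.  The same reflection yields
  the centroids.
\<close>

section \<open>The noise reflection\<close>

abbreviation attribute :: "'n point \<Rightarrow> int"
  where "attribute z \<equiv> snd (snd z)"

text \<open>Vectors without a noise part. The centroids have this shape, and so does the sum of any
  feature vector and its reflection.\<close>

definition plane_vector :: "'n::finite \<Rightarrow> 'n \<Rightarrow> real \<Rightarrow> real \<Rightarrow> real ^ 'n"
  where "plane_vector s c p q = p *\<^sub>R axis s 1 + q *\<^sub>R axis c 1"

definition negate_noise :: "'n::finite \<Rightarrow> 'n \<Rightarrow> real ^ 'n \<Rightarrow> real ^ 'n"
  where "negate_noise s c x = (\<chi> j. if j = s \<or> j = c then x $ j else - x $ j)"

definition reflect :: "'n::finite \<Rightarrow> 'n \<Rightarrow> 'n point \<Rightarrow> 'n point"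
  where "reflect s c z = (negate_noise s c (feature z), snd z)"

lemma snd_reflect [simp]: "snd (reflect s c z) = snd z"
  by (simp add: reflect_def)

lemma feature_reflect [simp]: "feature (reflect s c z) = negate_noise s c (feature z)"
  by (simp add: reflect_def)

text \<open>The noise coordinates cancel and the two named ones double; with
  \<open>s \<noteq> c\<close> the two axes do not interfere.\<close>

lemma add_negate_noise:
  assumes "s \<noteq> c"
  shows "x + negate_noise s c x = 2 *\<^sub>R plane_vector s c (x $ s) (x $ c)"
  using assms by (simp add: vec_eq_iff plane_vector_def negate_noise_def axis_def)

lemma norm_negate_noise: "norm (negate_noise s c x) = norm x"
  unfolding norm_vec_def negate_noise_def L2_set_def
  by (intro arg_cong[of _ _ sqrt] sum.cong) auto

section \<open>Measurability of the data model\<close>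

lemma borel_measurable_vec_lambda [measurable (raw)]:
  fixes f :: "'a \<Rightarrow> 'n::finite \<Rightarrow> real"
  assumes [measurable]: "\<And>j. (\<lambda>x. f x j) \<in> borel_measurable M"
  shows "(\<lambda>x. \<chi> j. f x j) \<in> borel_measurable M"
proof -
  have "(\<lambda>x. (\<chi> j. f x j) \<bullet> i) \<in> borel_measurable M" if "i \<in> Basis" for i :: "real ^ 'n"
  proof -
    from that obtain j where "i = axis j 1"
      by (auto simp: Basis_vec_def)
    then show ?thesis by (simp add: inner_axis)
  qed
  then show ?thesis
    by (simp add: borel_measurable_euclidean_space[where 'c = "real ^ 'n"])
qed

lemma feature_measurable [measurable]: "fst \<in> borel_measurable point_space"
  unfolding point_space_def by measurable

lemma feature_component_measurable [measurable]:
  "(\<lambda>z. feature z $ j) \<in> borel_measurable point_space"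
  by (rule measurable_compose[OF feature_measurable]) simp

lemma label_measurable [measurable]: "(\<lambda>z. label z) \<in> measurable point_space (count_space UNIV)"
  unfolding point_space_def by measurable

lemma attribute_measurable [measurable]:
  "(\<lambda>z. attribute z) \<in> measurable point_space (count_space UNIV)"
  unfolding point_space_def by measurable

text \<open>Label and attribute range over countable types, so the product of their discrete
  sigma-algebras is discrete. The law of the pair can then be compared with a
  \<open>pmf\<close>.\<close>

lemma snd_measurable [measurable]:
  "snd \<in> measurable point_space (count_space UNIV)"
proof -
  have "snd \<in> measurable point_space (count_space UNIV \<Otimes>\<^sub>M count_space UNIV)"
    unfolding point_space_def by measurable
  then show ?thesis
    by (simp add: pair_measure_countable)
qed

lemma space_point_space [simp]: "space point_space = UNIV"
  by (simp add: point_space_def space_pair_measure)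

lemma negate_noise_measurable [measurable]:
  "negate_noise s c \<in> borel_measurable borel"
  unfolding negate_noise_def
  by (intro borel_measurable_vec_lambda) (auto intro: borel_measurable_uminus)

lemma reflect_measurable [measurable]: "reflect s c \<in> measurable point_space point_space"
  unfolding reflect_def point_space_def by measurable

lemma prob_space_noise_measure: "prob_space (noise_measure s c)"
  unfolding noise_measure_def by (intro prob_space_PiM prob_space_normal_density) auto

lemma feature_vector_measurable [measurable]:
  "feature_vector s c B y a \<in> borel_measurable (noise_measure s c)"
proof -
  have "(\<lambda>\<delta>. if j = s then B * of_int a else if j = c then of_int y else \<delta> j)
      \<in> borel_measurable (noise_measure s c)" for j
  \<comment> \<open>\<open>noise_measure\<close> has components only off \<open>s\<close> and
    \<open>c\<close>, so a projection is available only there; the other two coordinates are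
    constant in the noise.\<close>
  proof (cases "j \<in> - {s, c}")
    case True
    then have "(\<lambda>\<delta>. \<delta> j) \<in> measurable (noise_measure s c) (density lborel std_normal_density)"
      unfolding noise_measure_def by (rule measurable_component_singleton)
    with True show ?thesis by auto
  next
    case False
    then show ?thesis by (cases "j = s") auto
  qed
  then show ?thesis
    unfolding feature_vector_def by (intro borel_measurable_vec_lambda)
qed

text \<open>The pair of label and attribute takes countably many values, so measurability in the
  noise for each fixed pair suffices.\<close>

lemma data_map_measurable [measurable]:
  "(\<lambda>((y, a), \<delta>). (feature_vector s c B y a \<delta>, y, a))
    \<in> measurable (measure_pmf p \<Otimes>\<^sub>M noise_measure s c) point_space"
proof -
  have "(\<lambda>w. (\<lambda>v w. (feature_vector s c B (fst v) (snd v) (snd w), v)) (fst w) w)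
      \<in> measurable (measure_pmf p \<Otimes>\<^sub>M noise_measure s c) point_space"
    by (rule measurable_compose_countable[where g = fst]) 
       (auto simp: point_space_def intro!: measurable_Pair measurable_compose[OF measurable_snd] feature_vector_measurable)
  then show ?thesis
    by (simp add: case_prod_unfold)
qed

lemma sets_data_model [simp]: "sets (data_model s c B \<rho>) = sets point_space"
  by (simp add: data_model_def)

lemma space_data_model [simp]: "space (data_model s c B \<rho>) = UNIV"
  by (simp add: data_model_def)

lemma measurable_data_model [simp]:
  "measurable (data_model s c B \<rho>) N = measurable point_space N"
  by (rule measurable_cong_sets) auto

lemma prob_space_data_model: "prob_space (data_model s c B \<rho>)"
proof -
  interpret noise: prob_space "noise_measure s c" by (rule prob_space_noise_measure)
  interpret pair_prob_space "measure_pmf (label_attribute_pmf \<rho>)" "noise_measure s c" ..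
  show ?thesis
    unfolding data_model_def by (rule prob_space_distr) simp
qed

section \<open>Symmetry of the noise and of the data law\<close>

lemma distr_density_std_normal_uminus:
  "distr (density lborel std_normal_density) (density lborel std_normal_density) uminus
    = density lborel std_normal_density"
proof -
  \<comment> \<open>Lebesgue measure is invariant under negation, and the density is even.\<close>
  have "density lborel std_normal_density = density (distr lborel borel uminus) std_normal_density"
    by (simp add: lborel_distr_uminus)
  also have "\<dots> = distr (density lborel (\<lambda>x. ennreal (std_normal_density (- x)))) borel uminus"
    by (subst density_distr) auto
  also have "\<dots> = distr (density lborel std_normal_density) (density lborel std_normal_density) uminus"
    by (rule distr_cong) (auto simp: normal_density_def)
  finally show ?thesis ..
qed

text \<open>The product law is invariant because each factor is. \<open>compose\<close> restricts to
  the index set, so the negated family is again extensional, as the product space demands.\<close>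

lemma distr_noise_uminus:
  "distr (noise_measure s c) (noise_measure s c) (compose (- {s, c}) uminus) = noise_measure s c"
  unfolding noise_measure_def
  by (subst distr_PiM_finite_prob_space')
     (auto simp: distr_density_std_normal_uminus prob_space_normal_density)

text \<open>Reflecting a generated point amounts to generating it from the negated noise with the
  same label and attribute, and negation leaves the joint law of pair and noise unchanged.\<close>

lemma distr_reflect:
  "distr (data_model s c B \<rho>) point_space (reflect s c) = data_model s c B \<rho>"
proof -
  let ?P = "measure_pmf (label_attribute_pmf \<rho>)"
  let ?N = "noise_measure s c"
  let ?neg = "compose (- {s, c}) uminus :: ('a \<Rightarrow> real) \<Rightarrow> _"
  let ?f = "\<lambda>((y, a), \<delta>). (feature_vector s c B y a \<delta>, y, a)"
  interpret noise: prob_space ?N by (rule prob_space_noise_measure)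
  have neg [measurable]: "?neg \<in> measurable ?N ?N"
    unfolding noise_measure_def compose_def by measurable
  have "?P \<Otimes>\<^sub>M ?N = distr ?P ?P (\<lambda>x. x) \<Otimes>\<^sub>M distr ?N ?N ?neg"
    by (simp add: distr_noise_uminus)
  also have "\<dots> = distr (?P \<Otimes>\<^sub>M ?N) (?P \<Otimes>\<^sub>M ?N) (\<lambda>(x, y). (x, ?neg y))"
    by (subst pair_measure_distr) (auto simp: distr_noise_uminus noise.sigma_finite_measure_axioms)
  finally have inv: "distr (?P \<Otimes>\<^sub>M ?N) (?P \<Otimes>\<^sub>M ?N) (\<lambda>(x, y). (x, ?neg y)) = ?P \<Otimes>\<^sub>M ?N" ..
  have "data_model s c B \<rho> = distr (distr (?P \<Otimes>\<^sub>M ?N) (?P \<Otimes>\<^sub>M ?N) (\<lambda>(x, y). (x, ?neg y))) point_space ?f"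
    by (simp add: inv data_model_def)
  also have "\<dots> = distr (?P \<Otimes>\<^sub>M ?N) point_space (?f \<circ> (\<lambda>(x, y). (x, ?neg y)))"
    by (rule distr_distr) measurable
  also have "?f \<circ> (\<lambda>(x, y). (x, ?neg y)) = reflect s c \<circ> ?f"
    by (auto simp: fun_eq_iff reflect_def negate_noise_def feature_vector_def vec_eq_iff compose_def)
  also have "distr (?P \<Otimes>\<^sub>M ?N) point_space (reflect s c \<circ> ?f) = distr (data_model s c B \<rho>) point_space (reflect s c)"
    unfolding data_model_def by (rule distr_distr[symmetric]) measurable
  finally show ?thesis ..
qed

section \<open>The law of label and attribute, and the almost sure shape of a point\<close>

lemma distr_data_model_snd:
  "distr (data_model s c B \<rho>) (count_space UNIV) snd = measure_pmf (label_attribute_pmf \<rho>)"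
proof -
  interpret noise: prob_space "noise_measure s c" by (rule prob_space_noise_measure)
  have "distr (data_model s c B \<rho>) (count_space UNIV) snd =
    distr (measure_pmf (label_attribute_pmf \<rho>) \<Otimes>\<^sub>M noise_measure s c) (count_space UNIV) fst"
    unfolding data_model_def
    by (subst distr_distr[OF snd_measurable data_map_measurable]) (simp add: comp_def case_prod_unfold)
  also have "\<dots> = distr (measure_pmf (label_attribute_pmf \<rho>) \<Otimes>\<^sub>M noise_measure s c) (measure_pmf (label_attribute_pmf \<rho>)) fst"
    by (rule distr_cong) auto
  also have "\<dots> = measure_pmf (label_attribute_pmf \<rho>)"
    by (rule noise.distr_pair_fst)
  finally show ?thesis .
qed

lemma pmf_label_attribute:
  assumes "0 \<le> \<rho>" "\<rho> \<le> 1" "y \<in> classes" "a \<in> classes"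
  shows "pmf (label_attribute_pmf \<rho>) (y, a) = (if a = y then \<rho> / 2 else (1 - \<rho>) / 2)"
  using assms unfolding label_attribute_pmf_def classes_def
  by (auto simp: pmf_bind integral_pmf_of_set indicator_def)

lemma set_pmf_label_attribute: "set_pmf (label_attribute_pmf \<rho>) \<subseteq> classes \<times> classes"
  unfolding label_attribute_pmf_def classes_def by (auto split: if_splits)

text \<open>The data law lives on the whole type of points, where feature, label and attribute are
  unrelated. This predicate collects the relations between them that hold almost surely.\<close>

definition typical :: "'n::finite \<Rightarrow> 'n \<Rightarrow> real \<Rightarrow> 'n point \<Rightarrow> bool"
  where "typical s c B z \<longleftrightarrow> snd z \<in> classes \<times> classes \<and>
    feature z $ s = B * of_int (attribute z) \<and> feature z $ c = of_int (label z)"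

lemma typical_reflect: "typical s c B z \<Longrightarrow> typical s c B (reflect s c z)"
  by (auto simp: typical_def negate_noise_def reflect_def)

text \<open>The relations are read off from the generating map. As \<open>feature_vector\<close>
  tests for \<open>s\<close> first, coordinate \<open>c\<close> holds the label by virtue of
  \<open>s \<noteq> c\<close>.\<close>

lemma AE_data_model:
  assumes "s \<noteq> c"
  shows "AE z in data_model s c B \<rho>. typical s c B z"
proof -
  interpret noise: prob_space "noise_measure s c" by (rule prob_space_noise_measure)
  have "AE z in data_model s c B \<rho>. snd z \<in> classes \<times> classes"
  proof -
    have "AE v in distr (data_model s c B \<rho>) (count_space UNIV) snd. v \<in> classes \<times> classes"
      unfolding distr_data_model_snd using set_pmf_label_attribute by (auto intro: AE_pmfI)
    then show ?thesis
      by (subst (asm) AE_distr_iff) auto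
  qed
  moreover have "AE z in data_model s c B \<rho>. feature z $ s = B * of_int (attribute z) \<and>
     feature z $ c = of_int (label z)"
  proof -
    have "{z \<in> space point_space. feature z $ s = B * of_int (attribute z) \<and> feature z $ c = of_int (label z)}
        \<in> sets point_space"
      by measurable
    then show ?thesis
      unfolding data_model_def using assms
      by (subst AE_distr_iff[OF data_map_measurable]) (auto simp: feature_vector_def)
  qed
  ultimately show ?thesis by (auto simp: typical_def)
qed

lemma abs_of_int_classes: "k \<in> classes \<Longrightarrow> \<bar>of_int k :: real\<bar> = 1"
  by (auto simp: classes_def)

section \<open>Integrability of the features\<close>

lemma integrable_noise_component:
  assumes "j \<in> - {s, c}"
  shows "integrable (noise_measure s c) (\<lambda>\<delta>. \<delta> j)"
proof -
  let ?g = "density lborel std_normal_density"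
  have "integrable ?g (\<lambda>x. x)"
    using integrable_std_normal_distribution_moment[of 1] by simp
  also have "?g = distr (noise_measure s c) ?g (\<lambda>\<delta>. \<delta> j)"
    unfolding noise_measure_def using assms
    by (intro distr_PiM_component[symmetric, where M = "\<lambda>_. ?g"]) (auto intro: prob_space_normal_density)
  finally show ?thesis
    by (rule integrable_distr[rotated])
       (use assms in \<open>auto simp: noise_measure_def intro!: measurable_component_singleton\<close>)
qed

text \<open>The two named coordinates are almost surely bounded, by \<open>\<bar>B\<bar>\<close> and
  by 1; a noise coordinate has a finite Gaussian first moment.\<close>

lemma integrable_feature_component:
  assumes "s \<noteq> c"
  shows "integrable (data_model s c B \<rho>) (\<lambda>z. feature z $ j)"
proof (cases "j \<in> {s, c}")
  case True
  interpret prob_space "data_model s c B \<rho>" by (rule prob_space_data_model)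
  show ?thesis
  proof (rule integrable_const_bound)
    show "AE z in data_model s c B \<rho>. norm (feature z $ j) \<le> \<bar>B\<bar> + 1"
      using AE_data_model[OF assms] by eventually_elim (use True in \<open>auto simp: typical_def abs_mult abs_of_int_classes\<close>)
  qed simp
next
  case False
  let ?P = "measure_pmf (label_attribute_pmf \<rho>)"
  let ?N = "noise_measure s c"
  interpret noise: prob_space ?N by (rule prob_space_noise_measure)
  interpret pair_prob_space ?P ?N ..
  have [measurable]: "(\<lambda>\<delta>. \<delta> j) \<in> borel_measurable ?N"
    using integrable_noise_component[of j s c] False by auto
  have "integrable (?P \<Otimes>\<^sub>M ?N) (\<lambda>w. snd w j)"
    using False by (intro Fubini_integrable) (auto intro!: integrable_noise_component)
  also have "(\<lambda>w. snd w j) = (\<lambda>w. feature ((\<lambda>((y, a), \<delta>). (feature_vector s c B y a \<delta>, y, a)) w) $ j)"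
    using False by (auto simp: feature_vector_def fun_eq_iff)
  finally show ?thesis
    unfolding data_model_def by (subst integrable_distr_eq[OF data_map_measurable]) auto
qed

text \<open>The norm is dominated by the sum of the absolute values of the coordinates.\<close>

lemma integrable_feature:
  assumes "s \<noteq> c"
  shows "integrable (data_model s c B \<rho>) fst"
proof (rule Bochner_Integration.integrable_bound)
  show "integrable (data_model s c B \<rho>) (\<lambda>z. \<Sum>j\<in>UNIV. \<bar>feature z $ j\<bar>)"
    by (intro Bochner_Integration.integrable_sum integrable_abs integrable_feature_component assms)
  show "AE z in data_model s c B \<rho>. norm (feature z) \<le> norm (\<Sum>j\<in>UNIV. \<bar>feature z $ j\<bar>)"
    by (intro AE_I2) (auto simp: sum_nonneg intro: order_trans[OF norm_le_l1_cart])
qed simp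

section \<open>Conditional expectation given an event\<close>

lemma uniform_measure_eq_density:
  assumes "0 < measure M A"
  shows "uniform_measure M A = density M (\<lambda>x. ennreal (indicator A x / measure M A))"
proof -
  \<comment> \<open>\<open>measure\<close> is 0 wherever \<open>emeasure\<close> is infinite, so
    positivity already gives finiteness.\<close>
  from assms have "emeasure M A \<noteq> top"
    by (auto simp: measure_def)
  then have "emeasure M A = ennreal (measure M A)"
    by (rule emeasure_eq_ennreal_measure)
  then have "indicator A x / emeasure M A = ennreal (indicator A x / measure M A)" for x
    using assms by (auto simp: indicator_def divide_ennreal simp flip: ennreal_1)
  then show ?thesis
    by (simp add: uniform_measure_def)
qed

lemma integrable_uniform_measure:
  fixes f :: "'a \<Rightarrow> 'b::{banach, second_countable_topology}"
  assumes [measurable]: "A \<in> sets M" "f \<in> borel_measurable M" and "0 < measure M A"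
    and "integrable M (\<lambda>x. indicat_real A x *\<^sub>R f x)"
  shows "integrable (uniform_measure M A) f"
proof -
  have "integrable M (\<lambda>x. (1 / measure M A) *\<^sub>R (indicat_real A x *\<^sub>R f x))"
    using assms by (intro integrable_scaleR_right)
  then show ?thesis
    using assms by (subst uniform_measure_eq_density) (auto simp: integrable_density)
qed

lemma event_expectation_eq:
  fixes f :: "'a \<Rightarrow> 'b::{banach, second_countable_topology}"
  assumes [measurable]: "A \<in> sets M" "f \<in> borel_measurable M" and "0 < measure M A"
  shows "event_expectation M A f = (1 / measure M A) *\<^sub>R (LINT x|M. indicat_real A x *\<^sub>R f x)"
proof -
  have "event_expectation M A f = (LINT x|M. (indicat_real A x / measure M A) *\<^sub>R f x)"
    unfolding event_expectation_def using assms
    by (subst uniform_measure_eq_density) (auto simp: integral_density)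
  also have "\<dots> = (LINT x|M. (1 / measure M A) *\<^sub>R (indicat_real A x *\<^sub>R f x))"
    by (simp add: mult.commute)
  finally show ?thesis by (simp only: integral_scaleR_right)
qed

section \<open>The centroids\<close>

lemma expectation_label_attribute:
  fixes h :: "int \<times> int \<Rightarrow> real"
  assumes "0 \<le> \<rho>" "\<rho> \<le> 1"
  shows "(LINT z|data_model s c B \<rho>. h (snd z)) =
    (\<rho> * h (1, 1) + (1 - \<rho>) * h (1, -1) + (1 - \<rho>) * h (-1, 1) + \<rho> * h (-1, -1)) / 2"
proof -
  have "(LINT z|data_model s c B \<rho>. h (snd z)) = (LINT v|distr (data_model s c B \<rho>) (count_space UNIV) snd. h v)"
    by (subst integral_distr) auto
  also have "\<dots> = (\<Sum>v\<in>classes \<times> classes. pmf (label_attribute_pmf \<rho>) v * h v)"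
    unfolding distr_data_model_snd using set_pmf_label_attribute
    by (subst integral_measure_pmf_real[where A = "classes \<times> classes"]) (auto simp: classes_def)
  also have "\<dots> = (\<Sum>y\<in>classes. \<Sum>a\<in>classes. (if a = y then \<rho> / 2 else (1 - \<rho>) / 2) * h (y, a))"
    by (subst sum.cartesian_product) (auto intro!: sum.cong simp: pmf_label_attribute assms)
  also have "\<dots> = (\<rho> * h (1, 1) + (1 - \<rho>) * h (1, -1) + (1 - \<rho>) * h (-1, 1) + \<rho> * h (-1, -1)) / 2"
    by (simp add: classes_def field_simps)
  finally show ?thesis .
qed

text \<open>Averaging with the reflected integral removes the noise and leaves functions of label
  and attribute. The spurious coordinate is \<open>B\<close> times the mean
  \<open>(2 * \<rho> - 1) * k\<close> of the attribute within class \<open>k\<close>.\<close>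

lemma centroid_eq:
  assumes "s \<noteq> c" "0 \<le> \<rho>" "\<rho> \<le> 1" "k \<in> classes"
  shows "centroid s c B \<rho> k = plane_vector s c (B * (2 * \<rho> - 1) * of_int k) (of_int k)"
proof -
  let ?P = "data_model s c B \<rho>"
  let ?A = "{z :: 'a point. label z = k}"
  let ?I = "LINT z|?P. indicat_real ?A z *\<^sub>R feature z"
  interpret prob_space ?P by (rule prob_space_data_model)
  have A [measurable]: "?A \<in> sets point_space"
    using measurable_sets[OF label_measurable, of "{k}"] by (simp add: vimage_def)
  have k: "k = 1 \<or> k = -1" using assms by (auto simp: classes_def)
  \<comment> \<open>The indicator of class \<open>k\<close> and the attribute cut off to that class:
    the two functions of the pair to which the integral reduces.\<close>
  define h1 h2 where "h1 v = (if fst v = k then 1 else 0 :: real)"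
    and "h2 v = (if fst v = k then of_int (snd v) else 0 :: real)" for v :: "int \<times> int"
  have h1: "(LINT z|?P. h1 (snd z)) = 1 / 2"
    using k by (subst expectation_label_attribute) (auto simp: assms h1_def)
  have h2: "(LINT z|?P. h2 (snd z)) = (2 * \<rho> - 1) * of_int k / 2"
    using k by (subst expectation_label_attribute) (auto simp: assms h2_def field_simps)
  have prob: "measure ?P ?A = 1 / 2"
  proof -
    have "measure ?P ?A = (LINT z|?P. indicator ?A z)"
      by simp
    also have "\<dots> = (LINT z|?P. h1 (snd z))"
      by (intro Bochner_Integration.integral_cong) (auto simp: h1_def)
    finally show ?thesis using h1 by simp
  qed
  have int: "integrable ?P (\<lambda>z. indicat_real ?A z *\<^sub>R feature z)"
    using integrable_feature[OF assms(1)] by (intro integrable_mult_indicator) auto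
  have meas [measurable]: "(\<lambda>z. indicat_real ?A z *\<^sub>R feature z) \<in> borel_measurable point_space"
    by measurable
  have refl: "indicat_real ?A (reflect s c z) = indicat_real ?A z" for z
    by (simp add: indicator_def)
  have "integrable (distr ?P point_space (reflect s c)) (\<lambda>z. indicat_real ?A z *\<^sub>R feature z)"
    using int by (simp add: distr_reflect)
  then have int': "integrable ?P (\<lambda>z. indicat_real ?A z *\<^sub>R negate_noise s c (feature z))"
    by (subst (asm) integrable_distr_eq) (auto simp: refl)
  have "?I = (LINT z|distr ?P point_space (reflect s c). indicat_real ?A z *\<^sub>R feature z)"
    by (simp add: distr_reflect)
  also have "\<dots> = (LINT z|?P. indicat_real ?A z *\<^sub>R negate_noise s c (feature z))"
    by (subst integral_distr) (auto simp: refl)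
  \<comment> \<open>One of the two copies is replaced by its reflection, so that the noise cancels
    pointwise under the integral.\<close>
  finally have "?I + ?I = ?I + (LINT z|?P. indicat_real ?A z *\<^sub>R negate_noise s c (feature z))"
    by simp
  also have "\<dots> = (LINT z|?P. indicat_real ?A z *\<^sub>R (feature z + negate_noise s c (feature z)))"
    unfolding scaleR_add_right using int int' by (rule Bochner_Integration.integral_add[symmetric])
  \<comment> \<open>Almost surely on class \<open>k\<close>, coordinate \<open>s\<close> is
    \<open>B\<close> times the attribute and coordinate \<open>c\<close> is
    \<open>k\<close>.\<close>
  also have "\<dots> = (LINT z|?P. (2 * B * h2 (snd z)) *\<^sub>R axis s 1 + (2 * of_int k * h1 (snd z)) *\<^sub>R axis c 1)"
  proof (rule integral_cong_AE)
    show "AE z in ?P. indicat_real ?A z *\<^sub>R (feature z + negate_noise s c (feature z)) =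
        (2 * B * h2 (snd z)) *\<^sub>R axis s 1 + (2 * of_int k * h1 (snd z)) *\<^sub>R axis c 1"
      using AE_data_model[OF assms(1)]
      by eventually_elim
         (auto simp: typical_def add_negate_noise[OF assms(1)] plane_vector_def h1_def h2_def indicator_def scaleR_add_right)
  qed (auto simp: h1_def h2_def)
  also have "\<dots> = (2 * B * (LINT z|?P. h2 (snd z))) *\<^sub>R axis s 1 + (2 * of_int k * (LINT z|?P. h1 (snd z))) *\<^sub>R axis c 1"
  proof -
    have "integrable ?P (\<lambda>z. h1 (snd z))"
      by (rule integrable_const_bound[where B = 1]) (auto simp: h1_def)
    moreover have "integrable ?P (\<lambda>z. h2 (snd z))"
    proof (rule integrable_const_bound[where B = 1])
      show "AE z in ?P. norm (h2 (snd z)) \<le> 1"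
        using AE_data_model[OF assms(1)]
        by eventually_elim (auto simp: typical_def h2_def abs_of_int_classes)
    qed (simp add: h2_def)
    ultimately show ?thesis by simp
  qed
  also have "\<dots> = plane_vector s c (B * (2 * \<rho> - 1) * of_int k) (of_int k)"
    by (simp add: h1 h2 plane_vector_def)
  \<comment> \<open>Class \<open>k\<close> has probability 1/2, so doubling the integral is exactly
    the normalisation in the conditional expectation.\<close>
  finally have "2 *\<^sub>R ?I = plane_vector s c (B * (2 * \<rho> - 1) * of_int k) (of_int k)"
    by (simp add: scaleR_2)
  then show ?thesis
    unfolding centroid_def by (subst event_expectation_eq) (simp_all add: prob)
qed


section \<open>The relative distance\<close>

lemma relative_distance_eq_Min:
  "relative_distance s c B \<rho> z = (norm (feature z - centroid s c B \<rho> (label z)))\<^sup>2 -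
    Min ((\<lambda>u. (norm (feature z - centroid s c B \<rho> u))\<^sup>2) ` (classes - {label z}))"
proof -
  let ?f = "\<lambda>u. (norm (feature z - centroid s c B \<rho> u))\<^sup>2"
  let ?S = "classes - {label z}"
  have S: "finite ?S" "?S \<noteq> {}" by (auto simp: classes_def)
  \<comment> \<open>The chosen minimiser attains the minimum. Passing to \<open>Min\<close> removes
    the choice made by \<open>arg_min_on\<close>, which would obstruct measurability.\<close>
  have "Min (?f ` ?S) = ?f (arg_min_on ?f ?S)"
    using S arg_min_if_finite(1)[OF S, of ?f] by (intro Min_eqI) (auto intro: arg_min_least)
  then show ?thesis
    by (simp add: relative_distance_def nearest_other_class_def)
qed

text \<open>The label is treated as a countable parameter. Measurability concerns all points, hence
  the third case, where the label lies outside \<open>classes\<close> and the minimum runs over both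
  classes.\<close>

lemma relative_distance_measurable [measurable]:
  "relative_distance s c B \<rho> \<in> borel_measurable point_space"
proof -
  let ?f = "\<lambda>z u. (norm (feature z - centroid s c B \<rho> u))\<^sup>2"
  have "(\<lambda>z. (\<lambda>l z. ?f z l - Min (?f z ` (classes - {l}))) (label z) z) \<in> borel_measurable point_space"
  proof (rule measurable_compose_countable[OF _ label_measurable])
    fix l :: int
    have [measurable]: "(\<lambda>z. ?f z u) \<in> borel_measurable point_space" for u
      by measurable
    consider "l = 1" | "l = -1" | "l \<noteq> 1" "l \<noteq> -1" by blast
    then show "(\<lambda>z. ?f z l - Min (?f z ` (classes - {l}))) \<in> borel_measurable point_space"
    proof cases
      case 1
      then have "classes - {l} = {-1}" by (auto simp: classes_def)
      then show ?thesis by simp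
    next
      case 2
      then have "classes - {l} = {1}" by (auto simp: classes_def)
      then show ?thesis by simp
    next
      case 3
      then have "classes - {l} = {1, -1}" by (auto simp: classes_def)
      then show ?thesis by simp
    qed
  qed
  then show ?thesis
    by (simp add: relative_distance_eq_Min[abs_def])
qed

text \<open>The two centroids are opposite vectors \<open>C\<close> and \<open>- C\<close>, so the
  difference of squared norms collapses to -4 times the inner product of the feature with
  \<open>C\<close>. As \<open>C\<close> lies in the plane of the named coordinates, the noise drops
  out.\<close>

lemma relative_distance_typical:
  assumes "s \<noteq> c" "0 \<le> \<rho>" "\<rho> \<le> 1" and typical: "typical s c B z"
  shows "relative_distance s c B \<rho> z =
    - 4 * (B\<^sup>2 * (2 * \<rho> - 1) * of_int (attribute z * label z) + 1)"
proof -
  have l: "label z \<in> classes" "- label z \<in> classes" "classes - {label z} = {- label z}"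
    using typical by (auto simp: typical_def classes_def)
  let ?C = "centroid s c B \<rho> (label z)"
  have "centroid s c B \<rho> (- label z) = - ?C"
    using l assms(1-3) by (simp add: centroid_eq plane_vector_def)
  then have "relative_distance s c B \<rho> z = - 4 * (feature z \<bullet> ?C)"
    by (simp add: relative_distance_eq_Min l power2_norm_eq_inner inner_diff inner_add inner_commute)
  also have "feature z \<bullet> ?C = B * of_int (attribute z) * (B * (2 * \<rho> - 1) * of_int (label z)) + of_int (label z) * of_int (label z)"
    unfolding centroid_eq[OF assms(1-3) l(1)] plane_vector_def inner_add_right inner_scaleR_right inner_axis
    using typical by (simp add: typical_def)
  also have "of_int (label z) * of_int (label z) = (1::real)"
    using l(1) by (auto simp: classes_def)
  finally show ?thesis
    by (simp add: power2_eq_square algebra_simps)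
qed

text \<open>With \<open>t = B\<^sup>2 * (2 * \<rho> - 1)\<close> the hypothesis says
  \<open>1 < t\<^sup>2\<close>, and \<open>\<rho> > 1 / 2\<close> makes \<open>t\<close>
  nonnegative, so \<open>t > 1\<close>. The distance is \<open>4 * (t - 1)\<close> if the attribute
  opposes the label and \<open>- 4 * (t + 1)\<close> otherwise.\<close>

lemma relative_distance_pos_iff:
  assumes "s \<noteq> c" "1 / 2 < \<rho>" "\<rho> < 1" "1 - (2 * \<rho> - 1)\<^sup>2 * B ^ 4 < 0" "typical s c B z"
  shows "relative_distance s c B \<rho> z > 0 \<longleftrightarrow> attribute z = - label z"
proof -
  let ?t = "B\<^sup>2 * (2 * \<rho> - 1)"
  have "1\<^sup>2 < ?t\<^sup>2"
    using assms(4) by (simp add: power_mult_distrib mult.commute flip: power_mult)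
  then have "1 < ?t"
    by (rule power_less_imp_less_base) (use assms in auto)
  moreover have "relative_distance s c B \<rho> z = - 4 * (?t * of_int (attribute z * label z) + 1)"
    using assms by (intro relative_distance_typical) auto
  moreover have "attribute z * label z = (if attribute z = - label z then -1 else 1)"
    using assms by (auto simp: typical_def classes_def)
  ultimately show ?thesis
    by (auto split: if_splits)
qed

section \<open>Measurability of the group sizes and of the balanced mean\<close>

lemma sum_filter_lessThan:
  fixes f :: "nat \<Rightarrow> 'a::comm_monoid_add"
  shows "sum f {i. i < n \<and> P i} = (\<Sum>i<n. if P i then f i else 0)"
  using sum.inter_filter[of "{..<n}" f P] by simp

lemma real_card_filter_lessThan:
  fixes n :: nat
  shows "real (card {i. i < n \<and> P i}) = (\<Sum>i<n. if P i then 1 else 0)"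
  using sum_filter_lessThan[of "\<lambda>_. 1 :: real" n P] by simp

lemma V_indices_eq:
  "V_indices s c B \<rho> n k z = {i. i < n \<and> label (z i) = k \<and> \<not> relative_distance s c B \<rho> (z i) > 0}"
  by (auto simp: V_indices_def U_indices_def)

text \<open>A sum over a random index set is rewritten as a sum over the fixed range of sample
  indices with measurable summands.\<close>

lemma card_U_indices_measurable [measurable]:
  assumes [measurable]: "\<And>i. i < n \<Longrightarrow> (\<lambda>\<omega>. z \<omega> i) \<in> measurable M point_space"
  shows "(\<lambda>\<omega>. real (card (U_indices s c B \<rho> n k (z \<omega>)))) \<in> borel_measurable M"
    and "(\<lambda>\<omega>. real (card (V_indices s c B \<rho> n k (z \<omega>)))) \<in> borel_measurable M"
  unfolding U_indices_def V_indices_eq real_card_filter_lessThan by measurable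

lemma balanced_mean_measurable:
  assumes [measurable]: "\<And>i. i < n \<Longrightarrow> (\<lambda>\<omega>. z \<omega> i) \<in> measurable M point_space"
  shows "(\<lambda>\<omega>. balanced_mean s c B \<rho> n k (z \<omega>)) \<in> borel_measurable M"
proof -
  have "(\<lambda>\<omega>. \<Sum>i\<in>U_indices s c B \<rho> n k (z \<omega>). feature (z \<omega> i)) \<in> borel_measurable M"
    unfolding U_indices_def sum_filter_lessThan by measurable
  moreover have "(\<lambda>\<omega>. \<Sum>i\<in>V_indices s c B \<rho> n k (z \<omega>). feature (z \<omega> i)) \<in> borel_measurable M"
    unfolding V_indices_eq sum_filter_lessThan by measurable
  ultimately show ?thesis
    unfolding balanced_mean_def using card_U_indices_measurable[OF assms] by measurable
qed


section \<open>The balanced mean restricted to the conditioning event\<close>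

lemma indices_cong:
  assumes "\<And>i. i < n \<Longrightarrow> z i = w i"
  shows "U_indices s c B \<rho> n k z = U_indices s c B \<rho> n k w"
    and "V_indices s c B \<rho> n k z = V_indices s c B \<rho> n k w"
  using assms by (auto simp: U_indices_def V_indices_eq)

text \<open>The counterpart of \<open>both_nonempty_event\<close> in the space of samples, to which
  the reflection and the law of the sample apply.\<close>

definition both_nonempty :: "'n::finite \<Rightarrow> 'n \<Rightarrow> real \<Rightarrow> real \<Rightarrow> nat \<Rightarrow> int \<Rightarrow> (nat \<Rightarrow> 'n point) set"
  where "both_nonempty s c B \<rho> n k =
    {z. card (U_indices s c B \<rho> n k z) > 0 \<and> card (V_indices s c B \<rho> n k z) > 0}"

text \<open>Extended by 0 outside the conditioning event, so that its integral over the whole space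
  is determined by the joint law of the sample.\<close>

definition restricted_mean ::
    "'n::finite \<Rightarrow> 'n \<Rightarrow> real \<Rightarrow> real \<Rightarrow> nat \<Rightarrow> int \<Rightarrow> (nat \<Rightarrow> 'n point) \<Rightarrow> real ^ 'n"
  where "restricted_mean s c B \<rho> n k z =
    indicat_real (both_nonempty s c B \<rho> n k) z *\<^sub>R balanced_mean s c B \<rho> n k z"

text \<open>This allows replacing a sample by its restriction to the first \<open>n\<close> indices,
  the form in which samples occur in a product space.\<close>

lemma restricted_mean_cong:
  assumes "\<And>i. i < n \<Longrightarrow> z i = w i"
  shows "restricted_mean s c B \<rho> n k z = restricted_mean s c B \<rho> n k w"
proof -
  have "balanced_mean s c B \<rho> n k z = balanced_mean s c B \<rho> n k w"
  proof -
    have "(\<Sum>i\<in>S. feature (z i)) = (\<Sum>i\<in>S. feature (w i))" if "S \<subseteq> {..<n}" for S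
      using assms that by (intro sum.cong) auto
    moreover have "U_indices s c B \<rho> n k w \<subseteq> {..<n}" "V_indices s c B \<rho> n k w \<subseteq> {..<n}"
      by (auto simp: U_indices_def V_indices_eq)
    ultimately show ?thesis
      by (simp add: balanced_mean_def indices_cong[OF assms])
  qed
  then show ?thesis
    by (simp add: restricted_mean_def both_nonempty_def indicator_def indices_cong[OF assms])
qed

lemma restricted_mean_measurable:
  assumes [measurable]: "\<And>i. i < n \<Longrightarrow> (\<lambda>\<omega>. z \<omega> i) \<in> measurable M point_space"
  shows "(\<lambda>\<omega>. restricted_mean s c B \<rho> n k (z \<omega>)) \<in> borel_measurable M"
proof -
  note [measurable] = card_U_indices_measurable[OF assms] balanced_mean_measurable[OF assms]
  have "restricted_mean s c B \<rho> n k (z \<omega>) =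
    (if real (card (U_indices s c B \<rho> n k (z \<omega>))) > 0 \<and> real (card (V_indices s c B \<rho> n k (z \<omega>))) > 0
     then balanced_mean s c B \<rho> n k (z \<omega>) else 0)" for \<omega>
    by (simp add: restricted_mean_def both_nonempty_def indicator_def)
  then show ?thesis by (simp del: of_nat_0_less_iff)
qed

text \<open>On the event both weights are at most 1, and the two groups are disjoint sets of sample
  indices. The bound is free of the random group sizes, so it yields integrability directly.\<close>

lemma norm_restricted_mean_le:
  "norm (restricted_mean s c B \<rho> n k z) \<le> (\<Sum>i<n. norm (feature (z i)))"
proof (cases "z \<in> both_nonempty s c B \<rho> n k")
  case True
  let ?U = "U_indices s c B \<rho> n k z"
  let ?V = "V_indices s c B \<rho> n k z"
  let ?f = "\<lambda>i. norm (feature (z i))"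
  have *: "norm ((1 / (2 * real (card S))) *\<^sub>R (\<Sum>i\<in>S. feature (z i))) \<le> (\<Sum>i\<in>S. ?f i)"
    if "card S > 0" for S
  proof -
    have "1 / (2 * real (card S)) * norm (\<Sum>i\<in>S. feature (z i)) \<le> 1 * (\<Sum>i\<in>S. ?f i)"
      using that by (intro mult_mono norm_sum) (auto simp: divide_simps)
    then show ?thesis by simp
  qed
  have "norm (restricted_mean s c B \<rho> n k z) \<le> (\<Sum>i\<in>?U. ?f i) + (\<Sum>i\<in>?V. ?f i)"
    using True
    by (auto simp: restricted_mean_def both_nonempty_def balanced_mean_def
        intro!: order_trans[OF norm_triangle_ineq] add_mono *)
  also have "\<dots> = (\<Sum>i\<in>?U \<union> ?V. ?f i)"
    by (rule sum.union_disjoint[symmetric]) (auto simp: U_indices_def V_indices_eq)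
  also have "\<dots> \<le> (\<Sum>i<n. ?f i)"
    by (rule sum_mono2) (auto simp: U_indices_def V_indices_eq)
  finally show ?thesis .
qed (simp add: restricted_mean_def sum_nonneg)

text \<open>Within each group the named coordinates are constant: \<open>(- B * k, k)\<close> on the
  minority group and \<open>(B * k, k)\<close> on the majority group. Adding the reflected sample
  leaves only these two vectors, whose spurious parts cancel.\<close>

lemma restricted_mean_add_reflect:
  assumes "s \<noteq> c" "1 / 2 < \<rho>" "\<rho> < 1" "1 - (2 * \<rho> - 1)\<^sup>2 * B ^ 4 < 0" "k \<in> classes"
    and typical: "\<And>i. i < n \<Longrightarrow> typical s c B (z i)"
  shows "restricted_mean s c B \<rho> n k z + restricted_mean s c B \<rho> n k (\<lambda>i. reflect s c (z i)) =
    indicat_real (both_nonempty s c B \<rho> n k) z *\<^sub>R plane_vector s c 0 (2 * of_int k)"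
proof -
  let ?r = "\<lambda>i. reflect s c (z i)"
  let ?U = "U_indices s c B \<rho> n k z"
  let ?V = "V_indices s c B \<rho> n k z"
  note pos = relative_distance_pos_iff[OF assms(1-4)]
  \<comment> \<open>For typical points the sign of the distance depends on label and attribute only,
    and the reflection keeps both.\<close>
  have U: "U_indices s c B \<rho> n k ?r = ?U"
    unfolding U_indices_def using pos[OF typical] pos[OF typical_reflect[OF typical]] by auto
  have V: "V_indices s c B \<rho> n k ?r = ?V"
    unfolding V_indices_def U by simp
  have both: "?r \<in> both_nonempty s c B \<rho> n k \<longleftrightarrow> z \<in> both_nonempty s c B \<rho> n k"
    by (simp add: both_nonempty_def U V)
  show ?thesis
  proof (cases "z \<in> both_nonempty s c B \<rho> n k")
    case True
    \<comment> \<open>The factor 1/2 in the weight cancels the doubling caused by the reflection,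
      and the group size cancels against the number of equal summands.\<close>
    have average: "(1 / (2 * real (card S))) *\<^sub>R (\<Sum>i\<in>S. feature (z i)) +
        (1 / (2 * real (card S))) *\<^sub>R (\<Sum>i\<in>S. feature (?r i)) = plane_vector s c p (of_int k)"
      if "card S > 0" "\<And>i. i \<in> S \<Longrightarrow> feature (z i) $ s = p \<and> feature (z i) $ c = of_int k" for S p
    proof -
      have "(\<Sum>i\<in>S. feature (z i)) + (\<Sum>i\<in>S. feature (?r i)) = (\<Sum>i\<in>S. 2 *\<^sub>R plane_vector s c p (of_int k))"
        unfolding sum.distrib[symmetric] using that(2)
        by (intro sum.cong) (simp_all add: add_negate_noise[OF assms(1)])
      also have "\<dots> = (2 * real (card S)) *\<^sub>R plane_vector s c p (of_int k)"
        by (simp add: sum_constant_scaleR del: sum_constant)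
      finally show ?thesis
        using that(1) by (simp flip: scaleR_add_right)
    qed
    have U_avg: "(1 / (2 * real (card ?U))) *\<^sub>R (\<Sum>i\<in>?U. feature (z i)) +
        (1 / (2 * real (card ?U))) *\<^sub>R (\<Sum>i\<in>?U. feature (?r i)) = plane_vector s c (- B * of_int k) (of_int k)"
    proof (rule average)
      fix i assume "i \<in> ?U"
      then show "feature (z i) $ s = - B * of_int k \<and> feature (z i) $ c = of_int k"
        using pos[OF typical, of i] typical[of i] by (auto simp: U_indices_def typical_def)
    qed (use True in \<open>simp add: both_nonempty_def\<close>)
    have V_avg: "(1 / (2 * real (card ?V))) *\<^sub>R (\<Sum>i\<in>?V. feature (z i)) +
        (1 / (2 * real (card ?V))) *\<^sub>R (\<Sum>i\<in>?V. feature (?r i)) = plane_vector s c (B * of_int k) (of_int k)"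
    proof (rule average)
      fix i assume "i \<in> ?V"
      then have "attribute (z i) = k"
        using pos[OF typical, of i] typical[of i] by (auto simp: V_indices_eq typical_def classes_def)
      with \<open>i \<in> ?V\<close> show "feature (z i) $ s = B * of_int k \<and> feature (z i) $ c = of_int k"
        using typical[of i] by (auto simp: V_indices_eq typical_def)
    qed (use True in \<open>simp add: both_nonempty_def\<close>)
    have "restricted_mean s c B \<rho> n k z + restricted_mean s c B \<rho> n k ?r =
      balanced_mean s c B \<rho> n k z + balanced_mean s c B \<rho> n k ?r"
      using True both by (simp add: restricted_mean_def)
    also have "\<dots> =
      plane_vector s c (- B * of_int k) (of_int k) + plane_vector s c (B * of_int k) (of_int k)"
      unfolding U_avg[symmetric] V_avg[symmetric] balanced_mean_def U V
      by (simp only: add_ac)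
    also have "\<dots> = plane_vector s c 0 (2 * of_int k)"
      by (simp add: plane_vector_def vec_eq_iff algebra_simps)
    finally show ?thesis using True by simp
  qed (simp add: restricted_mean_def both)
qed

section \<open>Probabilities of the minority and the majority group\<close>

lemma prob_label_relative_distance:
  assumes "s \<noteq> c" "1 / 2 < \<rho>" "\<rho> < 1" "1 - (2 * \<rho> - 1)\<^sup>2 * B ^ 4 < 0" "k \<in> classes"
  shows "measure (data_model s c B \<rho>) {z. label z = k \<and> relative_distance s c B \<rho> z > 0} = (1 - \<rho>) / 2"
    and "measure (data_model s c B \<rho>) {z. label z = k \<and> \<not> relative_distance s c B \<rho> z > 0} = \<rho> / 2"
proof -
  let ?P = "data_model s c B \<rho>"
  interpret prob_space ?P by (rule prob_space_data_model)
  \<comment> \<open>Up to a null set \<open>A\<close> fixes the pair of label and attribute, so its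
    probability is a single mass of the \<open>pmf\<close>.\<close>
  have prob: "measure ?P A = (if a = k then \<rho> / 2 else (1 - \<rho>) / 2)"
    if A: "A \<in> sets point_space" "\<And>z. typical s c B z \<Longrightarrow> z \<in> A \<longleftrightarrow> snd z = (k, a)" and "a \<in> classes" for A a
  proof -
    have sets: "snd -` {(k, a)} \<in> sets point_space"
      using measurable_sets[OF snd_measurable, of "{(k, a)}"] by simp
    have "measure ?P A = measure ?P (snd -` {(k, a)})"
    proof (rule finite_measure_eq_AE)
      show "AE z in ?P. z \<in> A \<longleftrightarrow> z \<in> snd -` {(k, a)}"
        using AE_data_model[OF assms(1)] by eventually_elim (simp add: A(2))
    qed (use A(1) sets in simp_all)
    also have "\<dots> = measure (distr ?P (count_space UNIV) snd) {(k, a)}"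
      by (subst measure_distr) simp_all
    also have "\<dots> = pmf (label_attribute_pmf \<rho>) (k, a)"
      by (simp add: distr_data_model_snd pmf.rep_eq)
    finally show ?thesis
      using pmf_label_attribute[of \<rho> k a] assms(2,3,5) that(3) by simp
  qed
  have sets: "{z \<in> space point_space. label z = k \<and> relative_distance s c B \<rho> z > 0} \<in> sets point_space"
    "{z \<in> space point_space. label z = k \<and> \<not> relative_distance s c B \<rho> z > 0} \<in> sets point_space"
    by measurable
  have k: "k \<noteq> - k" "- k \<in> classes" using assms(5) by (auto simp: classes_def)
  have pos: "(label z = k \<and> relative_distance s c B \<rho> z > 0) \<longleftrightarrow> snd z = (k, - k)"
    "(label z = k \<and> \<not> relative_distance s c B \<rho> z > 0) \<longleftrightarrow> snd z = (k, k)"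
    if "typical s c B z" for z
  proof -
    have "attribute z = - label z \<or> attribute z = label z"
      using that by (auto simp: typical_def classes_def)
    then show "(label z = k \<and> relative_distance s c B \<rho> z > 0) \<longleftrightarrow> snd z = (k, - k)"
      "(label z = k \<and> \<not> relative_distance s c B \<rho> z > 0) \<longleftrightarrow> snd z = (k, k)"
      unfolding relative_distance_pos_iff[OF assms(1-4) that] prod_eq_iff[of "snd z"]
      using k(1) by auto
  qed
  show "measure ?P {z. label z = k \<and> relative_distance s c B \<rho> z > 0} = (1 - \<rho>) / 2"
    using prob[of "{z. label z = k \<and> relative_distance s c B \<rho> z > 0}" "- k"] sets(1) pos(1) k by simp
  show "measure ?P {z. label z = k \<and> \<not> relative_distance s c B \<rho> z > 0} = \<rho> / 2"
    using prob[of "{z. label z = k \<and> \<not> relative_distance s c B \<rho> z > 0}" k] sets(2) pos(2) assms(5) by simp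
qed

section \<open>Invariance of the law of the sample under reflection\<close>

lemma integral_restricted_mean_reflect:
  assumes "prob_space M" "0 < n"
    and indep: "prob_space.indep_vars M (\<lambda>_. point_space) Z {..<n}"
    and distr: "\<And>i. i < n \<Longrightarrow> distr M point_space (Z i) = data_model s c B \<rho>"
  shows "(LINT \<omega>|M. restricted_mean s c B \<rho> n k (\<lambda>i. reflect s c (Z i \<omega>))) =
    (LINT \<omega>|M. restricted_mean s c B \<rho> n k (\<lambda>i. Z i \<omega>))"
proof -
  interpret prob_space M by fact
  let ?PM = "\<Pi>\<^sub>M i\<in>{..<n}. point_space :: 'b point measure"
  let ?R = "\<lambda>i \<omega>. reflect s c (Z i \<omega>)"
  \<comment> \<open>The integral depends only on the joint law of the first \<open>n\<close> points,
    which is the product of the data laws. This is applied to the sample and to its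
    reflection.\<close>
  have law: "(LINT \<omega>|M. restricted_mean s c B \<rho> n k (\<lambda>i. X i \<omega>)) =
      (LINT w|(\<Pi>\<^sub>M i\<in>{..<n}. data_model s c B \<rho>). restricted_mean s c B \<rho> n k w)"
    if X: "indep_vars (\<lambda>_. point_space) X {..<n}" "\<And>i. i < n \<Longrightarrow> distr M point_space (X i) = data_model s c B \<rho>" for X
  proof -
    have rv: "X i \<in> measurable M point_space" if "i < n" for i
      using X(1) that by (auto simp: indep_vars_def)
    \<comment> \<open>Independence as a product law is stated for a nonempty index set, hence
      \<open>0 < n\<close>.\<close>
    have "distr M ?PM (\<lambda>\<omega>. \<lambda>i\<in>{..<n}. X i \<omega>) = (\<Pi>\<^sub>M i\<in>{..<n}. distr M point_space (X i))"
      using X(1) by (subst (asm) indep_vars_iff_distr_eq_PiM') (use \<open>0 < n\<close> rv in auto)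
    also have "\<dots> = (\<Pi>\<^sub>M i\<in>{..<n}. data_model s c B \<rho>)"
      using X(2) by (intro PiM_cong) auto
    finally have "(LINT w|(\<Pi>\<^sub>M i\<in>{..<n}. data_model s c B \<rho>). restricted_mean s c B \<rho> n k w) =
        (LINT w|distr M ?PM (\<lambda>\<omega>. \<lambda>i\<in>{..<n}. X i \<omega>). restricted_mean s c B \<rho> n k w)"
      by simp
    also have "\<dots> = (LINT \<omega>|M. restricted_mean s c B \<rho> n k (\<lambda>i\<in>{..<n}. X i \<omega>))"
      by (intro integral_distr restricted_mean_measurable[where z = "\<lambda>w. w"] measurable_restrict
          measurable_component_singleton) (auto intro: rv)
    also have "\<dots> = (LINT \<omega>|M. restricted_mean s c B \<rho> n k (\<lambda>i. X i \<omega>))"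
      by (intro Bochner_Integration.integral_cong restricted_mean_cong) auto
    finally show ?thesis ..
  qed
  have rv: "Z i \<in> measurable M point_space" if "i < n" for i
    using indep that by (auto simp: indep_vars_def)
  \<comment> \<open>The reflection acts on each point separately, so it preserves independence as
    well as the marginal laws.\<close>
  have "indep_vars (\<lambda>_. point_space) ?R {..<n}"
    by (rule indep_vars_compose2[OF indep]) simp
  moreover have "distr M point_space (?R i) = data_model s c B \<rho>" if "i < n" for i
  proof -
    have "distr M point_space (?R i) = distr (distr M point_space (Z i)) point_space (reflect s c)"
      by (subst distr_distr) (auto simp: comp_def rv that)
    then show ?thesis using that by (simp add: distr distr_reflect)
  qed
  ultimately show ?thesis
    using law[of ?R] law[of Z] indep distr by simp
qed

section \<open>The conditional expectation of the balanced mean\<close>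

theorem theorem2:
  fixes M :: "'w measure"
    and Z :: "nat \<Rightarrow> 'w \<Rightarrow> 'n::finite point"
    and s c :: 'n
    and \<rho> B :: real
    and n :: nat
    and k :: int
  assumes "s \<noteq> c"
    and "1 / 2 < \<rho>" and "\<rho> < 1"
    and "1 \<le> B"
    and "1 - (2 * \<rho> - 1)\<^sup>2 * B ^ 4 < 0"
    and "2 \<le> n"
    and "prob_space M"
    and "prob_space.indep_vars M (\<lambda>_. point_space) Z {..<n}"
    and "\<And>i. i < n \<Longrightarrow> distr M point_space (Z i) = data_model s c B \<rho>"
    and "k \<in> classes"
  shows "measure M (both_nonempty_event M s c B \<rho> n k Z) > 0 \<and>
    integrable (uniform_measure M (both_nonempty_event M s c B \<rho> n k Z))
      (\<lambda>\<omega>. balanced_mean s c B \<rho> n k (\<lambda>i. Z i \<omega>)) \<and>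
    centroid s c B (1 / 2) k =
      event_expectation M (both_nonempty_event M s c B \<rho> n k Z)
        (\<lambda>\<omega>. balanced_mean s c B \<rho> n k (\<lambda>i. Z i \<omega>))"
proof -
  interpret prob_space M by fact
  let ?A = "both_nonempty_event M s c B \<rho> n k Z"
  let ?F = "\<lambda>\<omega>. restricted_mean s c B \<rho> n k (\<lambda>i. Z i \<omega>)"
  let ?G = "\<lambda>\<omega>. restricted_mean s c B \<rho> n k (\<lambda>i. reflect s c (Z i \<omega>))"
  let ?m = "\<lambda>\<omega>. balanced_mean s c B \<rho> n k (\<lambda>i. Z i \<omega>)"
  note distr = assms(9)
  have rv [measurable]: "Z i \<in> measurable M point_space" if "i < n" for i
    using assms(8) that by (auto simp: indep_vars_def)
  have card_meas [measurable]:
    "(\<lambda>\<omega>. real (card (U_indices s c B \<rho> n k (\<lambda>i. Z i \<omega>)))) \<in> borel_measurable M"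
    "(\<lambda>\<omega>. real (card (V_indices s c B \<rho> n k (\<lambda>i. Z i \<omega>)))) \<in> borel_measurable M"
    by (rule card_U_indices_measurable, simp add: rv)+
  have "{\<omega> \<in> space M. real (card (U_indices s c B \<rho> n k (\<lambda>i. Z i \<omega>))) > 0 \<and>
      real (card (V_indices s c B \<rho> n k (\<lambda>i. Z i \<omega>))) > 0} \<in> sets M"
    by measurable
  then have A [measurable]: "?A \<in> sets M"
    by (simp add: both_nonempty_event_def)
  have m [measurable]: "?m \<in> borel_measurable M"
    by (rule balanced_mean_measurable) (simp add: rv)
  have A_iff: "indicat_real (both_nonempty s c B \<rho> n k) (\<lambda>i. Z i \<omega>) = indicat_real ?A \<omega>"
    if "\<omega> \<in> space M" for \<omega>
    using that by (auto simp: both_nonempty_def both_nonempty_event_def indicator_def)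

  have pos: "measure M ?A > 0"
  proof -
    \<comment> \<open>It suffices that sample point 0 falls into the first group and sample point 1
      into the second. With \<open>2 \<le> n\<close> these are independent events of probabilities
      \<open>(1 - \<rho>) / 2\<close> and \<open>\<rho> / 2\<close>.\<close>
    let ?S = "\<lambda>i. {z. label z = k \<and> (relative_distance s c B \<rho> z > 0 \<longleftrightarrow> i = (0::nat))}"
    have S: "?S i \<in> sets point_space" for i
    proof -
      have "{z \<in> space point_space. label z = k \<and> (relative_distance s c B \<rho> z > 0 \<longleftrightarrow> i = (0::nat))} \<in> sets point_space"
        by measurable
      then show ?thesis by simp
    qed
    have "prob (Z i -` ?S i \<inter> space M) > 0" if "i \<in> {0, 1}" for i
    proof -
      have "i < n" using that assms(6) by auto
      have "prob (Z i -` ?S i \<inter> space M) = measure (data_model s c B \<rho>) (?S i)"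
        using measure_distr[OF rv[OF \<open>i < n\<close>] S[of i]] distr[OF \<open>i < n\<close>] by simp
      also have "\<dots> > 0"
        using that assms prob_label_relative_distance[OF assms(1-3,5,10)] by auto
      finally show ?thesis .
    qed
    then have "0 < (\<Prod>i\<in>{0, 1}. prob (Z i -` ?S i \<inter> space M))"
      by (intro prod_pos) auto
    also have "\<dots> = prob (\<Inter>i\<in>{0, 1}. Z i -` ?S i \<inter> space M)"
      using assms(6) S by (intro indep_varsD[OF assms(8), symmetric]) auto
    also have "\<dots> \<le> prob ?A"
    proof (rule finite_measure_mono[OF _ A])
      have "0 < n" "1 < n" using assms(6) by auto
      then show "(\<Inter>i\<in>{0, 1}. Z i -` ?S i \<inter> space M) \<subseteq> ?A"
        by (auto simp: both_nonempty_event_def card_gt_0_iff U_indices_def V_indices_eq)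
    qed
    finally show ?thesis .
  qed

  \<comment> \<open>This sum dominates both \<open>?F\<close> and \<open>?G\<close>, since the
    reflection preserves norms.\<close>
  have sum_int: "integrable M (\<lambda>\<omega>. \<Sum>i<n. norm (feature (Z i \<omega>)))"
  proof (intro Bochner_Integration.integrable_sum integrable_norm)
    fix i assume "i \<in> {..<n}"
    then have "integrable (distr M point_space (Z i)) fst"
      by (simp add: distr integrable_feature assms(1))
    then show "integrable M (\<lambda>\<omega>. feature (Z i \<omega>))"
      using \<open>i \<in> {..<n}\<close> by (subst (asm) integrable_distr_eq) (auto simp: rv)
  qed
  have F: "integrable M ?F"
    by (rule Bochner_Integration.integrable_bound[OF sum_int])
       (auto intro!: restricted_mean_measurable rv order_trans[OF norm_restricted_mean_le])
  have G: "integrable M ?G"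
    by (rule Bochner_Integration.integrable_bound[OF sum_int])
       (auto intro!: restricted_mean_measurable rv measurable_compose[OF rv reflect_measurable]
          order_trans[OF norm_restricted_mean_le] simp: norm_negate_noise)
  have F_eq: "?F \<omega> = indicat_real ?A \<omega> *\<^sub>R ?m \<omega>" if "\<omega> \<in> space M" for \<omega>
    using A_iff[OF that] by (simp add: restricted_mean_def)
  have int_F: "integrable M (\<lambda>\<omega>. indicat_real ?A \<omega> *\<^sub>R ?m \<omega>)"
    using F by (subst (asm) Bochner_Integration.integrable_cong[OF refl F_eq])

  have "AE \<omega> in M. \<forall>i\<in>{..<n}. typical s c B (Z i \<omega>)"
  proof (rule AE_finite_allI)
    fix i assume "i \<in> {..<n}"
    then have "distr M point_space (Z i) = data_model s c B \<rho>" by (simp add: distr)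
    then have "AE z in distr M point_space (Z i). typical s c B z"
      by (simp only: AE_data_model[OF assms(1)])
    then show "AE \<omega> in M. typical s c B (Z i \<omega>)"
      using \<open>i \<in> {..<n}\<close> by (intro AE_distrD[OF rv]) auto
  qed simp
  then have AE_sum: "AE \<omega> in M. ?F \<omega> + ?G \<omega> = indicat_real ?A \<omega> *\<^sub>R plane_vector s c 0 (2 * of_int k)"
    using AE_space
    by eventually_elim (simp add: restricted_mean_add_reflect[OF assms(1-3,5,10)] A_iff)

  \<comment> \<open>Replacing one copy by the reflected integral turns the integrand into a constant
    vector times the indicator of the event.\<close>
  have "2 *\<^sub>R (LINT \<omega>|M. ?F \<omega>) = (LINT \<omega>|M. ?F \<omega>) + (LINT \<omega>|M. ?G \<omega>)"
    using integral_restricted_mean_reflect[OF assms(7) _ assms(8) distr, of k] assms(6)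
    by (simp add: scaleR_2)
  also have "\<dots> = (LINT \<omega>|M. ?F \<omega> + ?G \<omega>)"
    by (rule Bochner_Integration.integral_add[OF F G, symmetric])
  also have "\<dots> = (LINT \<omega>|M. indicat_real ?A \<omega> *\<^sub>R plane_vector s c 0 (2 * of_int k))"
    using F G by (intro integral_cong_AE AE_sum) auto
  also have "\<dots> = measure M ?A *\<^sub>R plane_vector s c 0 (2 * of_int k)"
    using A by (subst integral_scaleR_left) (auto simp: less_top[symmetric])
  also have "plane_vector s c 0 (2 * of_int k) = 2 *\<^sub>R plane_vector s c 0 (of_int k)"
    by (simp add: plane_vector_def)
  finally have "2 *\<^sub>R (LINT \<omega>|M. ?F \<omega>) = 2 *\<^sub>R (measure M ?A *\<^sub>R plane_vector s c 0 (of_int k))"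
    by (simp only: scaleR_left_commute)
  then have "(LINT \<omega>|M. ?F \<omega>) = measure M ?A *\<^sub>R plane_vector s c 0 (of_int k)"
    by (simp only: scaleR_cancel_left) simp
  moreover have "(LINT \<omega>|M. ?F \<omega>) = (LINT \<omega>|M. indicat_real ?A \<omega> *\<^sub>R ?m \<omega>)"
    by (rule Bochner_Integration.integral_cong[OF refl F_eq])
  ultimately have "event_expectation M ?A ?m = plane_vector s c 0 (of_int k)"
    using pos by (simp add: event_expectation_eq)
  \<comment> \<open>At \<open>\<rho> = 1 / 2\<close> the factor \<open>2 * \<rho> - 1\<close>
    vanishes, and with it the spurious coordinate.\<close>
  moreover have "centroid s c B (1 / 2) k = plane_vector s c 0 (of_int k)"
    by (subst centroid_eq) (simp_all add: assms)
  ultimately show ?thesis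
    using pos int_F by (auto intro: integrable_uniform_measure)
qed

end
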